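(* Let $R$ be a finite commutative Frobenius ring with $q$ elements, let $C\subseteq R^N$ be a linear $P_R$-code over a poset $P$ of size $N$ with $s$ levels of sizes $n_1,\dots,n_s$ (so $N=n_1+\cdots+n_s$), and let $t_1,\dots,t_s$ be integers with $1\le t_i\le n_i$ for each $i$. Then the m-spotty poset level weight enumerator of the dual code $C^\perp$ satisfies $$M_W\left(C^\perp\mid z_1,\dots,z_s\right)=\frac{1}{|C|}\sum_{l}A_l\prod_{j=1}^{s}\left(\sum_{p_j=0}^{n_j}\left\{\sum_{a_j=0}^{p_j}(-1)^{a_j}(q-1)^{p_j-a_j}\binom{l_j}{a_j}\binom{n_j-l_j}{p_j-a_j}\right\}z_j^{\lceil p_j/t_j\rceil}\right),$$ where the sum $\sum_l$ runs over all $l=(l_1,\dots,l_s)$ with $0\le l_j\le n_j$ for each $j$, and $A_l$ is the number of codewords of $C$ having Hamming weight spectrum vector $l$.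
   Context: All rings are finite commutative Frobenius rings (a finite commutative ring $R$ is Frobenius if its character group $\widehat R=\mathrm{Hom}_{\mathbb Z}(R,\mathbb C^\times)$ is isomorphic to $R$ as an $R$-module). A linear code $C$ is an $R$-submodule of $R^N$. The coordinates of $R^N$ are labelled by the elements of a finite poset $P$ of size $N$, which is partitioned into $s$ levels, the $i$th level having $n_i\ge 1$ elements. Such a $C$ is called a linear $P_R$-code. The poset enters only through this partition of the coordinate set. Each $u\in R^N$ is written $u=(u^1,\dots,u^s)$, with $u^i=(u_{i1},\dots,u_{in_i})\in R^{n_i}$ the part of $u$ in level $i$. The inner product is $\langle u,v\rangle=\sum_{i=1}^s\sum_{j=1}^{n_i}u_{ij}v_{ij}$, and $C^\perp=\{v\in R^N:\langle u,v\rangle=0\text{ for all }u\in C\}$. $w$ denotes the Hamming weight (number of nonzero coordinates). The Hamming weight spectrum vector of $u\in R^N$ is $(w(u^1),\dots,w(u^s))$. For fixed $t_1,\dots,t_s$, the m-spotty poset level weight of the $i$th level is $w_{MP}(u^i)=\lceil w(u^i)/t_i\rceil$, and $w_{MP}(u)=\sum_{i=1}^s\lceil w(u^i)/t_i\rceil$. Let $z_1,\dots,z_s$ be commuting indeterminates. The m-spotty poset level weight enumerator of a linear $P_R$-code $C$ is $$M_W\left(C\mid z_1,\dots,z_s\right)=\sum_{u\in C}\prod_{i=1}^{s}z_i^{w_{MP}(u^i)}=\sum_{u\in C}\prod_{i=1}^{s}z_i^{\lceil w(u^i)/t_i\rceil},$$ and that of $C^\perp$ is defined by the same formula with $C^\perp$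 in place of $C$ (same levels and same $t_i$). Binomial conventions: $\binom{n}{k}=0$ if $n<k$ and $\binom00=1$. *)

theory Defs
  imports "HOL-Analysis.Analysis" "HOL-Library.Poly_Mapping"
begin

text \<open>
  Coordinates are labelled by a finite type \<open>'p\<close> and words are vectors of type \<open>'r ^ 'p\<close>. The
  levels are given by a family \<open>L :: nat \<Rightarrow> 'p set\<close>, of which only the members with index in
  \<open>{1..s}\<close> matter.
\<close>

text \<open>
  The characters are the homomorphisms from the additive group into the multiplicative group of
  nonzero complex numbers. As an \<open>R\<close>-module the character group has pointwise multiplication as its
  addition, and the scalar action \<open>(a \<psi>)(x) = \<psi>(a x)\<close>.
\<close>

definition additive_characters :: "('r::ab_group_add \<Rightarrow> complex) set" where
  "additive_characters = {\<psi>. (\<forall>x. \<psi> x \<noteq> 0) \<and> (\<forall>x y. \<psi> (x + y) = \<psi> x * \<psi> y)}"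

definition frobenius_ring :: "'r::comm_ring_1 itself \<Rightarrow> bool" where
  "frobenius_ring _ \<longleftrightarrow>
    (\<exists>\<phi> :: 'r \<Rightarrow> 'r \<Rightarrow> complex.
      bij_betw \<phi> UNIV additive_characters \<and>
      (\<forall>a b. \<phi> (a + b) = (\<lambda>x. \<phi> a x * \<phi> b x)) \<and>
      (\<forall>a b. \<phi> (a * b) = (\<lambda>x. \<phi> b (a * x))))"

lemma module_vector_scalar_mult: "module ((*s) :: 'r::comm_ring_1 \<Rightarrow> 'r ^ 'p \<Rightarrow> 'r ^ 'p)"
  by unfold_locales (vector algebra_simps)+

definition linear_code :: "('r::comm_ring_1 ^ 'p) set \<Rightarrow> bool" where
  "linear_code C \<longleftrightarrow> module.subspace (*s) C"

definition code_inner :: "'r::comm_ring_1 ^ 'p::finite \<Rightarrow> 'r ^ 'p \<Rightarrow> 'r" where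
  "code_inner u v = (\<Sum>x\<in>UNIV. u $ x * v $ x)"

definition dual_code :: "('r::comm_ring_1 ^ 'p::finite) set \<Rightarrow> ('r ^ 'p) set" where
  "dual_code C = {v. \<forall>u\<in>C. code_inner u v = 0}"

definition level_weight :: "'p set \<Rightarrow> 'r::zero ^ 'p \<Rightarrow> nat" where
  "level_weight B u = card {x \<in> B. u $ x \<noteq> 0}"

definition spectrum_vector :: "nat \<Rightarrow> (nat \<Rightarrow> 'p set) \<Rightarrow> 'r::zero ^ 'p \<Rightarrow> nat \<Rightarrow> nat" where
  "spectrum_vector s L u = (\<lambda>i\<in>{1..s}. level_weight (L i) u)"

definition spotty :: "nat \<Rightarrow> nat \<Rightarrow> nat" where
  "spotty t w = nat \<lceil>real w / real t\<rceil>"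

text \<open>
  Polynomials over the rationals in commuting indeterminates \<open>z\<^sub>0, z\<^sub>1, \<dots>\<close>: a finitely supported map
  \<open>nat \<Rightarrow>\<^sub>0 nat\<close> is the exponent vector of a monomial, and a polynomial is a finitely supported map
  from monomials to coefficients.
\<close>

type_synonym mpoly_rat = "(nat \<Rightarrow>\<^sub>0 nat) \<Rightarrow>\<^sub>0 rat"

definition mvar :: "nat \<Rightarrow> mpoly_rat" where
  "mvar i = Poly_Mapping.single (Poly_Mapping.single i 1) 1"

definition mconst :: "rat \<Rightarrow> mpoly_rat" where
  "mconst c = Poly_Mapping.single 0 c"

definition weight_enumerator ::
  "nat \<Rightarrow> (nat \<Rightarrow> 'p set) \<Rightarrow> (nat \<Rightarrow> nat) \<Rightarrow> ('r::zero ^ 'p) set \<Rightarrow> mpoly_rat" where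
  "weight_enumerator s L t C =
    (\<Sum>u\<in>C. \<Prod>i=1..s. mvar i ^ spotty (t i) (level_weight (L i) u))"

definition spectrum_count ::
  "nat \<Rightarrow> (nat \<Rightarrow> 'p set) \<Rightarrow> ('r::zero ^ 'p) set \<Rightarrow> (nat \<Rightarrow> nat) \<Rightarrow> nat" where
  "spectrum_count s L C l = card {u \<in> C. spectrum_vector s L u = l}"

end

theory Submission
  imports Defs
begin

text \<open>
  For a generating character \<open>\<psi>\<close>, the sum of \<open>\<psi> (u \<cdot> v)\<close> over \<open>u \<in> C\<close> and over all \<open>v\<close> with support \<open>S\<close>
  is computed in two ways: orthogonality on \<open>C\<close> gives \<open>|C|\<close> times the number of dual codewords with
  support \<open>S\<close>, while summing over \<open>v\<close> first gives a product over \<open>x \<in> S\<close> of factors \<open>q - 1\<close> or \<open>- 1\<close>,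
  according to whether \<open>u\<^sub>x\<close> vanishes. Both sides are integers, so the identity survives the passage
  from complex numbers to rational polynomials, where it only remains to sum over \<open>S\<close> level by level.
\<close>

definition vec_support :: "'r::zero ^ 'p \<Rightarrow> 'p set" where
  "vec_support u = {x. u $ x \<noteq> 0}"

lemma level_weight_eq_card_support: "level_weight B u = card (vec_support u \<inter> B)"
  by (auto simp: level_weight_def vec_support_def intro: arg_cong[where f = card])

subsection \<open>Subset sums\<close>

lemma sum_Pow_card:
  fixes h :: "nat \<Rightarrow> 'a::comm_semiring_1"
  assumes "finite A"
  shows "(\<Sum>T\<in>Pow A. h (card T)) = (\<Sum>a\<le>card A. of_nat (card A choose a) * h a)"
proof -
  have "(\<Sum>T\<in>Pow A. h (card T)) = (\<Sum>a\<le>card A. \<Sum>T | T \<in> Pow A \<and> card T = a. h (card T))"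
    using assms by (intro sum.group[symmetric]) (auto intro: card_mono)
  also have "\<dots> = (\<Sum>a\<le>card A. of_nat (card A choose a) * h a)"
    using assms by (intro sum.cong) (simp_all add: n_subsets)
  finally show ?thesis .
qed

text \<open>Split \<open>T\<close> into \<open>T \<inter> Z\<close> and \<open>T - Z\<close>: only
  the two sizes \<open>a\<close> and \<open>b\<close> matter, and binomials count the choices for
  each. Collecting terms with \<open>a + b = p\<close> gives the inner sum, which for
  \<open>c = -1\<close> and \<open>d = q - 1\<close> is the Krawtchouk polynomial of degree
  \<open>p\<close> at \<open>card Z\<close>.\<close>

lemma sum_Pow_weights_card:
  fixes c d :: "'a::comm_semiring_1" and g :: "nat \<Rightarrow> 'a"
  assumes "finite B" "Z \<subseteq> B"
  shows "(\<Sum>T\<in>Pow B. (\<Prod>x\<in>T. if x \<in> Z then c else d) * g (card T)) =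
    (\<Sum>p\<le>card B. (\<Sum>a\<le>p. c ^ a * d ^ (p - a) * of_nat (card Z choose a) *
      of_nat ((card B - card Z) choose (p - a))) * g p)"
proof -
  define l m where "l = card Z" and "m = card (B - Z)"
  have fin: "finite Z" "finite (B - Z)"
    using assms finite_subset by auto
  have m: "m = card B - card Z" and lm: "l + m = card B"
    using assms fin card_mono[OF assms] by (auto simp: l_def m_def card_Diff_subset)
  define F where "F a b = of_nat (l choose a) * of_nat (m choose b) * (c ^ a * d ^ b * g (a + b))" for a b
  have F0: "F a b = 0" if "a > l \<or> b > m" for a b
    using that by (auto simp: F_def binomial_eq_0)
  have "(\<Sum>T\<in>Pow B. (\<Prod>x\<in>T. if x \<in> Z then c else d) * g (card T)) =
      (\<Sum>(T, U)\<in>Pow Z \<times> Pow (B - Z). c ^ card T * d ^ card U * g (card T + card U))"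
  proof (rule sum.reindex_bij_witness[where i = "\<lambda>(T, U). T \<union> U" and j = "\<lambda>T. (T \<inter> Z, T - Z)"])
    fix T assume "T \<in> Pow B"
    hence T: "finite T" using assms finite_subset by auto
    have "card T = card (T \<inter> Z) + card (T - Z)"
      using T by (metis card_Int_Diff)
    moreover have "(\<Prod>x\<in>T. if x \<in> Z then c else d) = c ^ card (T \<inter> Z) * d ^ card (T - Z)"
      using T by (simp add: prod.If_cases Int_def set_diff_eq Collect_neg_eq)
    ultimately show "(case (T \<inter> Z, T - Z) of (T, U) \<Rightarrow> c ^ card T * d ^ card U * g (card T + card U)) =
        (\<Prod>x\<in>T. if x \<in> Z then c else d) * g (card T)" by simp
  qed (use assms in auto)
  also have "\<dots> = (\<Sum>T\<in>Pow Z. \<Sum>U\<in>Pow (B - Z). c ^ card T * d ^ card U * g (card T + card U))"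
    by (rule sum.cartesian_product[symmetric])
  also have "\<dots> = (\<Sum>T\<in>Pow Z. \<Sum>b\<le>m. of_nat (m choose b) * (c ^ card T * d ^ b * g (card T + b)))"
  proof (rule sum.cong[OF refl])
    fix T
    show "(\<Sum>U\<in>Pow (B - Z). c ^ card T * d ^ card U * g (card T + card U)) =
        (\<Sum>b\<le>m. of_nat (m choose b) * (c ^ card T * d ^ b * g (card T + b)))"
      unfolding m_def
      by (rule sum_Pow_card[OF fin(2), where h = "\<lambda>b. c ^ card T * d ^ b * g (card T + b)"])
  qed
  also have "\<dots> = (\<Sum>a\<le>l. \<Sum>b\<le>m. F a b)"
    using sum_Pow_card[OF fin(1), where h = "\<lambda>a. \<Sum>b\<le>m. of_nat (m choose b) * (c ^ a * d ^ b * g (a + b))"]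
    by (simp add: l_def F_def sum_distrib_left mult.assoc)
  also have "\<dots> = (\<Sum>(a, b)\<in>{..l} \<times> {..m}. F a b)"
    by (rule sum.cartesian_product)
  \<comment> \<open>The rectangle lies inside this triangle, and by \<open>F0\<close> the added
    terms vanish. The triangle can be summed along its diagonals \<open>a + b = p\<close>.\<close>
  also have "\<dots> = (\<Sum>(a, b)\<in>{(a, b). a + b \<le> l + m}. F a b)"
  proof (rule sum.mono_neutral_left)
    show "finite {(a, b). a + b \<le> l + m}"
      by (rule finite_subset[of _ "{..l + m} \<times> {..l + m}"]) auto
  qed (auto intro!: F0)
  also have "\<dots> = (\<Sum>p\<le>l + m. \<Sum>a\<le>p. F a (p - a))"
    by (rule sum.triangle_reindex_eq)
  also have "\<dots> = (\<Sum>p\<le>card B. (\<Sum>a\<le>p. c ^ a * d ^ (p - a) * of_nat (card Z choose a) *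
      of_nat ((card B - card Z) choose (p - a))) * g p)"
    unfolding lm by (simp add: F_def m l_def sum_distrib_left sum_distrib_right mult_ac)
  finally show ?thesis .
qed

text \<open>Choosing one subset in each block amounts to choosing one subset \<open>S\<close> of the
  union. Disjointness is what allows each choice to be recovered as
  \<open>S \<inter> L i\<close>.\<close>

lemma prod_sum_Pow_partition:
  fixes f :: "'b \<Rightarrow> 'a set \<Rightarrow> 'c::comm_semiring_1"
  assumes "finite I" "\<And>i. i \<in> I \<Longrightarrow> finite (L i)" "disjoint_family_on L I"
  shows "(\<Prod>i\<in>I. \<Sum>T\<in>Pow (L i). f i T) = (\<Sum>S\<in>Pow (\<Union>i\<in>I. L i). \<Prod>i\<in>I. f i (S \<inter> L i))"
proof -
  have "(\<Prod>i\<in>I. \<Sum>T\<in>Pow (L i). f i T) = (\<Sum>g\<in>PiE I (\<lambda>i. Pow (L i)). \<Prod>i\<in>I. f i (g i))"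
    using assms by (intro prod_sum_PiE) auto
  also have "\<dots> = (\<Sum>S\<in>Pow (\<Union>i\<in>I. L i). \<Prod>i\<in>I. f i (S \<inter> L i))"
  proof (rule sum.reindex_bij_witness[where i = "\<lambda>S. \<lambda>i\<in>I. S \<inter> L i" and j = "\<lambda>g. \<Union>i\<in>I. g i"])
    fix g assume g: "g \<in> PiE I (\<lambda>i. Pow (L i))"
    have *: "(\<Union>i\<in>I. g i) \<inter> L i = g i" if "i \<in> I" for i
      using assms(3) g that by (fastforce simp: disjoint_family_on_def PiE_iff)
    show "(\<lambda>i\<in>I. (\<Union>i\<in>I. g i) \<inter> L i) = g"
      using g * by (auto simp: PiE_iff extensional_def fun_eq_iff)
    show "(\<Prod>i\<in>I. f i ((\<Union>i\<in>I. g i) \<inter> L i)) = (\<Prod>i\<in>I. f i (g i))"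
      using * by simp
    show "(\<Union>i\<in>I. g i) \<in> Pow (\<Union>i\<in>I. L i)"
      using g by (auto simp: PiE_iff)
  qed auto
  finally show ?thesis .
qed

subsection \<open>Characters and duality\<close>

text \<open>Translation by \<open>h\<close> permutes \<open>H\<close> and multiplies the sum by
  \<open>f h\<close>, which differs from 1.\<close>

lemma sum_character_eq_0:
  fixes f :: "'a::ab_group_add \<Rightarrow> 'b::idom"
  assumes "\<And>x y. f (x + y) = f x * f y"
    and "\<And>x y. x \<in> H \<Longrightarrow> y \<in> H \<Longrightarrow> x + y \<in> H" "\<And>x. x \<in> H \<Longrightarrow> - x \<in> H"
    and "h \<in> H" "f h \<noteq> 1"
  shows "(\<Sum>x\<in>H. f x) = 0"
proof -
  have closed: "x - h \<in> H" if "x \<in> H" for x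
    using assms(2)[OF that assms(3)[OF assms(4)]] by simp
  have "(\<Sum>x\<in>H. f x) = (\<Sum>x\<in>H. f (h + x))"
    by (rule sum.reindex_bij_witness[where i = "\<lambda>x. h + x" and j = "\<lambda>x. x - h"])
      (use assms closed in auto)
  also have "\<dots> = f h * (\<Sum>x\<in>H. f x)"
    by (simp add: assms(1) sum_distrib_left)
  finally have "(f h - 1) * (\<Sum>x\<in>H. f x) = 0"
    by (simp add: algebra_simps)
  thus ?thesis using assms(5) by simp
qed

text \<open>The last clause says that the kernel of the character contains no nonzero ideal.
  \<open>\<psi> 0 = 1\<close> excludes the zero function.\<close>

definition generating_character :: "('r::comm_ring_1 \<Rightarrow> complex) \<Rightarrow> bool" where
  "generating_character \<psi> \<longleftrightarrow>
    \<psi> 0 = 1 \<and> (\<forall>x y. \<psi> (x + y) = \<psi> x * \<psi> y) \<and> (\<forall>b. (\<forall>r. \<psi> (b * r) = 1) \<longrightarrow> b = 0)"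

text \<open>The image of 1 under the module isomorphism works:
  \<open>\<phi> b x = \<phi> 1 (b * x)\<close>, so if \<open>\<phi> 1\<close> is trivial on the
  ideal generated by \<open>b\<close>, then \<open>\<phi> b\<close> is the trivial character
  \<open>\<phi> 0\<close>, and injectivity gives \<open>b = 0\<close>.\<close>

lemma frobenius_ring_generating_character:
  assumes "frobenius_ring TYPE('r::comm_ring_1)"
  shows "\<exists>\<psi> :: 'r \<Rightarrow> complex. generating_character \<psi>"
proof -
  obtain \<phi> :: "'r \<Rightarrow> 'r \<Rightarrow> complex" where
    bij: "bij_betw \<phi> UNIV additive_characters" and
    mult: "\<And>a b. \<phi> (a * b) = (\<lambda>x. \<phi> b (a * x))"
    using assms unfolding frobenius_ring_def by blast
  have char: "\<phi> a x \<noteq> 0" "\<phi> a (x + y) = \<phi> a x * \<phi> a y" for a x y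
    using bij_betwE[OF bij] by (auto simp: additive_characters_def)
  have zero: "\<phi> a 0 = 1" for a
    using char(2)[of a 0 0] char(1)[of a 0] by simp
  have phi: "\<phi> b x = \<phi> 1 (b * x)" for b x
    using mult[of b 1] by simp
  have "b = 0" if "\<forall>r. \<phi> 1 (b * r) = 1" for b
  proof -
    have "\<phi> b = \<phi> 0"
      using that by (simp add: fun_eq_iff phi[of b] phi[of 0] zero)
    thus ?thesis
      using bij by (auto simp: bij_betw_def dest: injD)
  qed
  thus ?thesis
    using char(2) zero by (intro exI[of _ "\<phi> 1"]) (simp add: generating_character_def)
qed

lemma sum_generating_character:
  fixes \<psi> :: "'r::{finite, comm_ring_1} \<Rightarrow> complex"
  assumes "generating_character \<psi>"
  shows "(\<Sum>r\<in>UNIV. \<psi> (a * r)) = (if a = 0 then of_nat CARD('r) else 0)"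
proof (cases "a = 0")
  case False
  then obtain r where "\<psi> (a * r) \<noteq> 1"
    using assms unfolding generating_character_def by blast
  then have "(\<Sum>r\<in>UNIV. \<psi> (a * r)) = 0"
    using assms by (intro sum_character_eq_0[where h = r])
      (auto simp: generating_character_def distrib_left)
  thus ?thesis using False by simp
qed (use assms in \<open>simp add: generating_character_def\<close>)

text \<open>If \<open>v\<close> is not in the dual, some codeword has nonzero inner product
  \<open>b\<close> with \<open>v\<close>, and some \<open>r\<close> has
  \<open>\<psi> (b * r) \<noteq> 1\<close>. Scaling the codeword by \<open>r\<close> stays in
  \<open>C\<close>, so the character is nontrivial on \<open>C\<close> and its sum vanishes. Closure
  under scalars, not just addition, is essential here.\<close>

lemma sum_generating_character_code:
  fixes C :: "('r::{finite, comm_ring_1} ^ 'p::finite) set"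
  assumes "generating_character \<psi>" "linear_code C"
  shows "(\<Sum>u\<in>C. \<psi> (code_inner u v)) = (if v \<in> dual_code C then of_nat (card C) else 0)"
proof (cases "v \<in> dual_code C")
  case True
  thus ?thesis using assms(1) by (simp add: dual_code_def generating_character_def)
next
  case False
  then obtain u where u: "u \<in> C" "code_inner u v \<noteq> 0"
    by (auto simp: dual_code_def)
  then obtain r where "\<psi> (code_inner u v * r) \<noteq> 1"
    using assms(1) unfolding generating_character_def by blast
  moreover have "code_inner u v * r = code_inner (r *s u) v"
    by (simp add: code_inner_def sum_distrib_left mult_ac)
  ultimately have ne: "\<psi> (code_inner (r *s u) v) \<noteq> 1" by simp
  have sub: "module.subspace (*s) C"
    using assms(2) by (simp add: linear_code_def)
  have mem: "r *s u \<in> C"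
    using module.subspace_scale[OF module_vector_scalar_mult sub] u by blast
  have add: "\<psi> (code_inner (x + y) v) = \<psi> (code_inner x v) * \<psi> (code_inner y v)" for x y
    using assms(1) by (simp add: code_inner_def generating_character_def distrib_right sum.distrib)
  have "(\<Sum>u\<in>C. \<psi> (code_inner u v)) = 0"
    using add mem ne module.subspace_add[OF module_vector_scalar_mult sub] module.subspace_neg[OF module_vector_scalar_mult sub]
    by (intro sum_character_eq_0[where h = "r *s u"]) auto
  thus ?thesis using False by simp
qed

text \<open>A vector with support \<open>S\<close> is an independent choice of a nonzero entry at
  each coordinate in \<open>S\<close> and of 0 elsewhere. Coordinates outside \<open>S\<close>
  contribute the factor 1.\<close>

lemma sum_vec_support_prod:
  fixes f :: "'p::finite \<Rightarrow> 'r::{finite, zero} \<Rightarrow> 'a::comm_semiring_1"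
  assumes "\<And>x. f x 0 = 1"
  shows "(\<Sum>v | vec_support v = S. \<Prod>x\<in>UNIV. f x (v $ x)) = (\<Prod>x\<in>S. \<Sum>r\<in>UNIV - {0}. f x r)"
proof -
  define A :: "'p \<Rightarrow> 'r set" where "A x = (if x \<in> S then UNIV - {0} else {0})" for x
  have "(\<Sum>v | vec_support v = S. \<Prod>x\<in>UNIV. f x (v $ x)) = (\<Sum>g\<in>PiE UNIV A. \<Prod>x\<in>UNIV. f x (g x))"
    by (rule sum.reindex_bij_witness[where i = vec_lambda and j = vec_nth])
      (auto simp: A_def vec_support_def PiE_iff split: if_splits)
  also have "\<dots> = (\<Prod>x\<in>UNIV. \<Sum>r\<in>A x. f x r)"
    by (rule prod_sum_PiE[symmetric]) auto
  also have "\<dots> = (\<Prod>x\<in>S. \<Sum>r\<in>UNIV - {0}. f x r)"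
    by (rule prod.mono_neutral_cong_right) (auto simp: A_def assms)
  finally show ?thesis .
qed

lemma macwilliams_support:
  fixes C :: "('r::{finite, comm_ring_1} ^ 'p::finite) set"
  assumes "frobenius_ring TYPE('r)" "linear_code C"
  shows "(\<Sum>u\<in>C. \<Prod>x\<in>S. if x \<in> vec_support u then - 1 else of_nat CARD('r) - 1) =
    (of_nat (card C) * of_nat (card {v \<in> dual_code C. vec_support v = S}) :: 'a::comm_ring_1)"
proof -
  obtain \<psi> :: "'r \<Rightarrow> complex" where \<psi>: "generating_character \<psi>"
    using frobenius_ring_generating_character[OF assms(1)] by blast
  have \<psi>_0: "\<psi> 0 = 1" and \<psi>_add: "\<psi> (x + y) = \<psi> x * \<psi> y" for x y
    using \<psi> by (auto simp: generating_character_def)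
  have \<psi>_sum: "\<psi> (\<Sum>x\<in>X. h x) = (\<Prod>x\<in>X. \<psi> (h x))" for X :: "'p set" and h
    by (induction X rule: infinite_finite_induct) (auto simp: \<psi>_0 \<psi>_add)
  \<comment> \<open>The weights are taken in \<open>int\<close> so that the identity, proved in the
    complex numbers, can be pulled back along the injective \<open>of_int\<close> and then mapped
    into any commutative ring.\<close>
  define w :: "'r ^ 'p \<Rightarrow> 'p \<Rightarrow> int"
    where "w u x = (if x \<in> vec_support u then - 1 else of_nat CARD('r) - 1)" for u x
  \<comment> \<open>Removing \<open>r = 0\<close> from the full character sum subtracts
    \<open>\<psi> 0 = 1\<close>, leaving \<open>q - 1\<close> or \<open>-1\<close>.\<close>
  have w: "of_int (w u x) = (\<Sum>r\<in>UNIV - {0}. \<psi> (u $ x * r))" for u x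
    using sum_generating_character[OF \<psi>, of "u $ x"]
    by (auto simp: w_def vec_support_def sum_diff1 \<psi>_0)
  have "of_int (\<Sum>u\<in>C. \<Prod>x\<in>S. w u x) = (\<Sum>u\<in>C. \<Prod>x\<in>S. \<Sum>r\<in>UNIV - {0}. \<psi> (u $ x * r))"
    by (simp add: w)
  also have "\<dots> = (\<Sum>u\<in>C. \<Sum>v | vec_support v = S. \<psi> (code_inner u v))"
    by (simp add: sum_vec_support_prod[symmetric] \<psi>_0 code_inner_def \<psi>_sum)
  also have "\<dots> = (\<Sum>v | vec_support v = S. \<Sum>u\<in>C. \<psi> (code_inner u v))"
    by (rule sum.swap)
  also have "\<dots> = (\<Sum>v | vec_support v = S. if v \<in> dual_code C then of_nat (card C) else 0)"
    by (simp add: sum_generating_character_code[OF \<psi> assms(2)])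
  also have "\<dots> = of_nat (card C) * of_nat (card {v \<in> dual_code C. vec_support v = S})"
    by (simp add: sum.If_cases Int_def conj_commute)
  also have "\<dots> = of_int (of_nat (card C) * of_nat (card {v \<in> dual_code C. vec_support v = S}))"
    by simp
  finally have "(\<Sum>u\<in>C. \<Prod>x\<in>S. w u x) =
      of_nat (card C) * of_nat (card {v \<in> dual_code C. vec_support v = S})"
    by (simp only: of_int_eq_iff)
  from arg_cong[OF this, of "of_int :: int \<Rightarrow> 'a"] show ?thesis
    by (simp add: w_def if_distrib[of of_int] cong: if_cong)
qed

subsection \<open>Weight enumerators\<close>

lemma mconst_0 [simp]: "mconst 0 = 0"
  and mconst_1 [simp]: "mconst 1 = 1"
  and mconst_add: "mconst (a + b) = mconst a + mconst b"
  and mconst_mult: "mconst (a * b) = mconst a * mconst b"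
  by (simp_all add: mconst_def single_add mult_single)

lemma mconst_of_nat: "mconst (of_nat k) = of_nat k"
  by (induction k) (simp_all add: mconst_add)

lemma mconst_power: "mconst (a ^ k) = mconst a ^ k"
  by (induction k) (simp_all add: mconst_mult)

lemma mconst_sum: "mconst (\<Sum>x\<in>A. f x) = (\<Sum>x\<in>A. mconst (f x))"
  by (induction A rule: infinite_finite_induct) (simp_all add: mconst_add)

lemma mconst_prod: "mconst (\<Prod>x\<in>A. f x) = (\<Prod>x\<in>A. mconst (f x))"
  by (induction A rule: infinite_finite_induct) (simp_all add: mconst_mult)

text \<open>The monomial of a word depends only on its support, so words are grouped by
  support.\<close>

lemma weight_enumerator_eq_sum_support:
  fixes D :: "('r::{finite, zero} ^ 'p::finite) set"
  shows "weight_enumerator s L t D =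
    (\<Sum>S\<in>UNIV. of_nat (card {v \<in> D. vec_support v = S}) *
      (\<Prod>i=1..s. mvar i ^ spotty (t i) (card (S \<inter> L i))))"
proof -
  have "weight_enumerator s L t D = (\<Sum>S\<in>UNIV. \<Sum>v | v \<in> D \<and> vec_support v = S.
      \<Prod>i=1..s. mvar i ^ spotty (t i) (card (vec_support v \<inter> L i)))"
    unfolding weight_enumerator_def level_weight_eq_card_support
    by (rule sum.group[symmetric]) auto
  thus ?thesis by simp
qed

text \<open>Codewords are grouped by spectrum vector. That vector lies in the extensional product
  because it is restricted to \<open>{1..s}\<close> and each level weight is at most the level
  size.\<close>

lemma sum_spectrum_count:
  fixes C :: "('r::{finite, zero} ^ 'p::finite) set" and F :: "(nat \<Rightarrow> nat) \<Rightarrow> 'a::comm_semiring_1"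
  assumes "\<And>i. i \<in> {1..s} \<Longrightarrow> card (L i) = n i"
  shows "(\<Sum>l \<in> (\<Pi>\<^sub>E j\<in>{1..s}. {0..n j}). of_nat (spectrum_count s L C l) * F l) =
    (\<Sum>u\<in>C. F (spectrum_vector s L u))"
proof -
  have "level_weight (L i) u \<le> n i" if "i \<in> {1..s}" for i and u :: "'r ^ 'p"
    unfolding level_weight_def assms[OF that, symmetric] by (rule card_mono) auto
  hence "(\<Sum>u\<in>C. F (spectrum_vector s L u)) =
      (\<Sum>l \<in> (\<Pi>\<^sub>E j\<in>{1..s}. {0..n j}). \<Sum>u | u \<in> C \<and> spectrum_vector s L u = l. F (spectrum_vector s L u))"
    by (intro sum.group[symmetric] finite_PiE) (auto simp: spectrum_vector_def PiE_iff)
  thus ?thesis by (simp add: spectrum_count_def)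
qed

theorem corollary4p2:
  fixes C :: "('r::{finite, comm_ring_1} ^ 'p::{finite, order}) set"
    and L :: "nat \<Rightarrow> 'p set"
    and s q :: nat
    and n t :: "nat \<Rightarrow> nat"
  assumes "frobenius_ring TYPE('r)"
    and "CARD('r) = q"
    and "linear_code C"
    and "disjoint_family_on L {1..s}"
    and "(\<Union>i\<in>{1..s}. L i) = UNIV"
    and "\<And>i. i \<in> {1..s} \<Longrightarrow> card (L i) = n i"
    and "\<And>i. i \<in> {1..s} \<Longrightarrow> 1 \<le> n i"
    and "\<And>i. i \<in> {1..s} \<Longrightarrow> 1 \<le> t i \<and> t i \<le> n i"
  shows "weight_enumerator s L t (dual_code C) =
    mconst (1 / of_nat (card C)) *
    (\<Sum>l \<in> (\<Pi>\<^sub>E j\<in>{1..s}. {0..n j}). of_nat (spectrum_count s L C l) *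
      (\<Prod>j=1..s. \<Sum>p=0..n j.
        mconst (\<Sum>a=0..p. (-1) ^ a * (of_nat q - 1) ^ (p - a) *
                  of_nat (l j choose a) * of_nat ((n j - l j) choose (p - a))) *
        mvar j ^ spotty (t j) p))"
proof -
  define w :: "'r ^ 'p::{finite, order} \<Rightarrow> 'p \<Rightarrow> rat"
    where "w u x = (if x \<in> vec_support u then - 1 else of_nat q - 1)" for u x
  define m :: "'p::{finite, order} set \<Rightarrow> mpoly_rat"
    where "m S = (\<Prod>j=1..s. mvar j ^ spotty (t j) (card (S \<inter> L j)))" for S
  define F :: "(nat \<Rightarrow> nat) \<Rightarrow> mpoly_rat" where "F l = (\<Prod>j=1..s. \<Sum>p=0..n j.
      mconst (\<Sum>a=0..p. (-1) ^ a * (of_nat q - 1) ^ (p - a) *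
                of_nat (l j choose a) * of_nat ((n j - l j) choose (p - a))) *
      mvar j ^ spotty (t j) p)" for l
  \<comment> \<open>The Krawtchouk factor of level \<open>j\<close> is unfolded into a sum over
    subsets of that level, with the support of \<open>u\<close> inside the level as the set
    \<open>Z\<close>.\<close>
  have level: "(\<Sum>p=0..n j. mconst (\<Sum>a=0..p. (-1) ^ a * (of_nat q - 1) ^ (p - a) *
        of_nat (level_weight (L j) u choose a) *
        of_nat ((n j - level_weight (L j) u) choose (p - a))) * mvar j ^ spotty (t j) p) =
      (\<Sum>T\<in>Pow (L j). mconst (\<Prod>x\<in>T. w u x) * mvar j ^ spotty (t j) (card T))"
    if j: "j \<in> {1..s}" for j u
  proof -
    have "mconst (\<Prod>x\<in>T. w u x) =
        (\<Prod>x\<in>T. if x \<in> vec_support u \<inter> L j then mconst (- 1) else mconst (of_nat q - 1))"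
      if "T \<in> Pow (L j)" for T
      unfolding mconst_prod using that by (intro prod.cong) (auto simp: w_def)
    hence "(\<Sum>T\<in>Pow (L j). mconst (\<Prod>x\<in>T. w u x) * mvar j ^ spotty (t j) (card T)) =
      (\<Sum>T\<in>Pow (L j). (\<Prod>x\<in>T. if x \<in> vec_support u \<inter> L j then mconst (- 1) else mconst (of_nat q - 1)) *
        mvar j ^ spotty (t j) (card T))"
      by (intro sum.cong) auto
    also have "\<dots> = (\<Sum>p\<le>card (L j). (\<Sum>a\<le>p. mconst (- 1) ^ a * mconst (of_nat q - 1) ^ (p - a) *
        of_nat (card (vec_support u \<inter> L j) choose a) *
        of_nat ((card (L j) - card (vec_support u \<inter> L j)) choose (p - a))) * mvar j ^ spotty (t j) p)"
      by (rule sum_Pow_weights_card) auto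
    finally show ?thesis
      by (simp add: assms(6)[OF j] level_weight_eq_card_support mconst_sum mconst_mult mconst_power
          mconst_of_nat atLeast0AtMost)
  qed
  \<comment> \<open>Multiplying the level sums merges the chosen subsets into one \<open>S\<close>
    ranging over all coordinate sets, since the levels partition the coordinates. The weights and
    the monomials both multiply across levels.\<close>
  have F: "F (spectrum_vector s L u) = (\<Sum>S\<in>UNIV. mconst (\<Prod>x\<in>S. w u x) * m S)" for u
  proof -
    have "F (spectrum_vector s L u) =
        (\<Prod>j=1..s. \<Sum>T\<in>Pow (L j). mconst (\<Prod>x\<in>T. w u x) * mvar j ^ spotty (t j) (card T))"
      unfolding F_def using level by (intro prod.cong) (auto simp: spectrum_vector_def)
    also have "\<dots> = (\<Sum>S\<in>UNIV. \<Prod>j=1..s. mconst (\<Prod>x\<in>S \<inter> L j. w u x) *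
        mvar j ^ spotty (t j) (card (S \<inter> L j)))"
      by (subst prod_sum_Pow_partition[OF _ _ assms(4)])
        (simp_all only: assms(5) finite Pow_UNIV finite_atLeastAtMost)
    also have "\<dots> = (\<Sum>S\<in>UNIV. mconst (\<Prod>x\<in>S. w u x) * m S)"
    proof (rule sum.cong[OF refl])
      fix S
      have "(\<Prod>x\<in>(\<Union>j\<in>{1..s}. S \<inter> L j). w u x) = (\<Prod>j=1..s. \<Prod>x\<in>S \<inter> L j. w u x)"
        using assms(4) by (intro prod.UNION_disjoint) (auto simp: disjoint_family_on_def)
      moreover have "(\<Union>j\<in>{1..s}. S \<inter> L j) = S"
        using assms(5) by blast
      ultimately show "(\<Prod>j=1..s. mconst (\<Prod>x\<in>S \<inter> L j. w u x) *
          mvar j ^ spotty (t j) (card (S \<inter> L j))) = mconst (\<Prod>x\<in>S. w u x) * m S"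
        by (simp add: m_def prod.distrib mconst_prod)
    qed
    finally show ?thesis .
  qed
  \<comment> \<open>A code contains the zero word, so its cardinality is invertible in the
    rationals.\<close>
  have "0 \<in> C"
    using assms(3) module.subspace_0[OF module_vector_scalar_mult] by (auto simp: linear_code_def)
  hence card: "(of_nat (card C) :: rat) \<noteq> 0"
    by auto
  \<comment> \<open>After exchanging the sums, the coefficient of \<open>m S\<close> is the left
    side of \<open>macwilliams_support\<close>, which turns it into a count of dual codewords with
    support \<open>S\<close>.\<close>
  have "(\<Sum>u\<in>C. F (spectrum_vector s L u)) = (\<Sum>S\<in>UNIV. mconst (\<Sum>u\<in>C. \<Prod>x\<in>S. w u x) * m S)"
    unfolding F mconst_sum sum_distrib_right by (rule sum.swap)
  also have "\<dots> = (\<Sum>S\<in>UNIV.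
      mconst (of_nat (card C) * of_nat (card {v \<in> dual_code C. vec_support v = S})) * m S)"
    unfolding w_def assms(2)[symmetric] by (subst macwilliams_support[OF assms(1,3)]) (rule refl)
  also have "\<dots> = mconst (of_nat (card C)) * weight_enumerator s L t (dual_code C)"
    by (simp add: weight_enumerator_eq_sum_support m_def mconst_mult mconst_of_nat
        sum_distrib_left mult.assoc)
  finally have main: "mconst (1 / of_nat (card C)) * (\<Sum>u\<in>C. F (spectrum_vector s L u)) =
      mconst (1 / of_nat (card C) * of_nat (card C)) * weight_enumerator s L t (dual_code C)"
    by (simp only: mconst_mult mult.assoc)
  have count: "(\<Sum>l \<in> (\<Pi>\<^sub>E j\<in>{1..s}. {0..n j}). of_nat (spectrum_count s L C l) * F l) =
      (\<Sum>u\<in>C. F (spectrum_vector s L u))"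
    by (rule sum_spectrum_count) (rule assms(6))
  have "mconst (1 / of_nat (card C) * of_nat (card C)) = 1"
    using card by simp
  thus ?thesis
    unfolding F_def[symmetric] count main by (simp only: mult_1)
qed

end
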